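(* Let $h_1\ge\dots\ge h_n>0$ be integers and $m,k\ge1$ integers. If there exist an $m\mathrm{RP}(h_1\dots h_n)$ and a $k\mathrm{RP}(h_1\dots h_n)$, then there exists an $(m+k-1)\mathrm{RP}(h_1\dots h_n)$.
   Context: Let $N=\sum h_i$. An $m$-dimensional latin hypercube of order $N$ is a function $L:[N]^m\to[N]$ such that whenever two index tuples differ in exactly one coordinate their values differ. A subhypercube of order $h$ is the restriction of $L$ to $T_1\times\dots\times T_m$ with $|T_j|=h$ for all $j$ which is itself a latin hypercube of order $h$ (on $h$ symbols); subhypercubes are disjoint if their index sets are disjoint in every coordinate and their symbol sets are disjoint. An $m\mathrm{RP}(h_1\dots h_n)$ ($m$-realization) is an $m$-dimensional latin hypercube of order $N$ with pairwise disjoint subhypercubes of orders $h_1,\dots,h_n$. *)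

theory Defs
  imports Complex_Main "HOL-Library.FuncSet"
begin

text \<open>
  An \<open>m\<close>-tuple is a function in the extensional product \<open>\<Pi>\<^sub>E j\<in>{1..m}. T j\<close>; only the values
  of \<open>L\<close> on that product matter. The index sets \<open>T j\<close> and the symbol set \<open>S\<close> are parameters
  rather than \<open>{1..h}\<close>, so that the same notion applies to subhypercubes.
\<close>

definition latin_hypercube ::
  "nat \<Rightarrow> nat \<Rightarrow> (nat \<Rightarrow> nat set) \<Rightarrow> nat set \<Rightarrow> ((nat \<Rightarrow> nat) \<Rightarrow> nat) \<Rightarrow> bool" where
  "latin_hypercube m h T S L \<longleftrightarrow>
     (\<forall>j\<in>{1..m}. finite (T j) \<and> card (T j) = h) \<and>
     finite S \<and> card S = h \<and>
     L \<in> (\<Pi>\<^sub>E j\<in>{1..m}. T j) \<rightarrow> S \<and>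
     (\<forall>x\<in>(\<Pi>\<^sub>E j\<in>{1..m}. T j). \<forall>y\<in>(\<Pi>\<^sub>E j\<in>{1..m}. T j).
        (\<exists>!j. j \<in> {1..m} \<and> x j \<noteq> y j) \<longrightarrow> L x \<noteq> L y)"

definition subhypercube ::
  "nat \<Rightarrow> nat \<Rightarrow> ((nat \<Rightarrow> nat) \<Rightarrow> nat) \<Rightarrow> nat \<Rightarrow> (nat \<Rightarrow> nat set) \<Rightarrow> nat set \<Rightarrow> bool" where
  "subhypercube m N L h T S \<longleftrightarrow>
     (\<forall>j\<in>{1..m}. T j \<subseteq> {1..N}) \<and> S \<subseteq> {1..N} \<and> latin_hypercube m h T S L"

definition disjoint_subhypercubes ::
  "nat \<Rightarrow> (nat \<Rightarrow> nat set) \<Rightarrow> nat set \<Rightarrow> (nat \<Rightarrow> nat set) \<Rightarrow> nat set \<Rightarrow> bool" where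
  "disjoint_subhypercubes m T S T' S' \<longleftrightarrow>
     (\<forall>j\<in>{1..m}. T j \<inter> T' j = {}) \<and> S \<inter> S' = {}"

text \<open>\<open>realization m n h L\<close>: the hypercube \<open>L\<close> is an \<open>mRP(h\<^sub>1 \<dots> h\<^sub>n)\<close>, where \<open>h\<^sub>i = h i\<close>.\<close>

definition realization ::
  "nat \<Rightarrow> nat \<Rightarrow> (nat \<Rightarrow> nat) \<Rightarrow> ((nat \<Rightarrow> nat) \<Rightarrow> nat) \<Rightarrow> bool" where
  "realization m n h L \<longleftrightarrow>
     (let N = (\<Sum>i=1..n. h i) in
        latin_hypercube m N (\<lambda>_. {1..N}) {1..N} L \<and>
        (\<exists>T S. (\<forall>i\<in>{1..n}. subhypercube m N L (h i) (T i) (S i)) \<and>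
               (\<forall>i\<in>{1..n}. \<forall>i'\<in>{1..n}. i \<noteq> i' \<longrightarrow>
                  disjoint_subhypercubes m (T i) (S i) (T i') (S i'))))"

end

theory Submission
  imports Defs "HOL-Library.Disjoint_Sets"
begin

text \<open>
  Feed the \<open>k\<close>-dimensional hypercube into the last coordinate of the \<open>m\<close>-dimensional one. Since the
  orders add up to \<open>N\<close>, the symbol sets of the subhypercubes of the former partition \<open>{1..N}\<close>, as do
  the last index sets of the subhypercubes of the latter; relabelling the symbols by a permutation
  that matches the two partitions block by block makes the subhypercubes compose as well.
\<close>

definition compose_hypercube ::
  "nat \<Rightarrow> nat \<Rightarrow> ((nat \<Rightarrow> nat) \<Rightarrow> nat) \<Rightarrow> (nat \<Rightarrow> nat) \<Rightarrow> ((nat \<Rightarrow> nat) \<Rightarrow> nat) \<Rightarrow> (nat \<Rightarrow> nat) \<Rightarrow> nat" where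
  "compose_hypercube m k A \<sigma> B x =
     A (\<lambda>j\<in>{1..m}. if j < m then x j else \<sigma> (B (\<lambda>l\<in>{1..k}. x (l + m - 1))))"

text \<open>The shift \<open>j + 1 - m\<close> inverts the shift \<open>l + m - 1\<close> of
  \<open>compose_hypercube\<close>: coordinates from \<open>m\<close> on are coordinates
  \<open>1\<close>, ..., \<open>k\<close> of the inner hypercube. The set \<open>T m\<close> does
  not occur, since coordinate \<open>m\<close> of the outer hypercube is filled by the relabelled
  value of the inner one.\<close>

definition compose_indices ::
  "nat \<Rightarrow> (nat \<Rightarrow> 'a set) \<Rightarrow> (nat \<Rightarrow> 'a set) \<Rightarrow> nat \<Rightarrow> 'a set" where
  "compose_indices m T U j = (if j < m then T j else U (j + 1 - m))"

text \<open>Each component is some \<open>T j\<close> or some \<open>U l\<close>. The predicate is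
  binary so that it also covers disjointness of two composed families; for properties of one family
  it ignores its second argument.\<close>

lemma compose_indices_all:
  assumes "j \<in> {1..m + k - 1}"
    and "\<And>j. j \<in> {1..m} \<Longrightarrow> P (T j) (T' j)" and "\<And>l. l \<in> {1..k} \<Longrightarrow> P (U l) (U' l)"
  shows "P (compose_indices m T U j) (compose_indices m T' U' j)"
proof (cases "j < m")
  case True
  then show ?thesis using assms by (simp add: compose_indices_def)
next
  case False
  then have "j + 1 - m \<in> {1..k}" using assms(1) by auto
  then show ?thesis using False assms(3) unfolding compose_indices_def by simp
qed

text \<open>Changing one coordinate of \<open>x\<close> changes exactly one coordinate of the
  argument of \<open>A\<close>: either the same one, below \<open>m\<close>, or the
  \<open>m\<close>-th, through \<open>B\<close> and the injective \<open>\<sigma>\<close>. The index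
  and symbol sets are arbitrary so that the lemma serves both the whole hypercube and each
  subhypercube.\<close>

lemma latin_hypercube_compose:
  assumes m: "m \<ge> 1" and k: "k \<ge> 1"
    and A: "latin_hypercube m h T S A"
    and B: "latin_hypercube k h U R B"
    and inj: "inj_on \<sigma> R" and \<sigma>: "\<sigma> ` R \<subseteq> T m"
  shows "latin_hypercube (m + k - 1) h (compose_indices m T U) S (compose_hypercube m k A \<sigma> B)"
proof -
  let ?X = "\<Pi>\<^sub>E j\<in>{1..m + k - 1}. compose_indices m T U j"
  \<comment> \<open>\<open>b x\<close> and \<open>a x\<close> are the arguments of \<open>B\<close>
    and \<open>A\<close>; they are restricted to lie in the extensional products, as the Latin
    property speaks of no other tuples.\<close>
  define b where "b x = (\<lambda>l\<in>{1..k}. x (l + m - 1))" for x :: "nat \<Rightarrow> nat"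
  define a where "a x = (\<lambda>j\<in>{1..m}. if j < m then x j else \<sigma> (B (b x)))" for x
  have L: "compose_hypercube m k A \<sigma> B x = A (a x)" for x
    unfolding compose_hypercube_def a_def b_def ..
  have b: "b x \<in> (\<Pi>\<^sub>E j\<in>{1..k}. U j)" if "x \<in> ?X" for x
  proof (unfold b_def, rule restrict_PiE_iff[THEN iffD2], rule ballI)
    fix l assume l: "l \<in> {1..k}"
    then have "l + m - 1 \<in> {1..m + k - 1}" using m by auto
    moreover have "\<not> l + m - 1 < m" "l + m - 1 + 1 - m = l" using l m by auto
    ultimately show "x (l + m - 1) \<in> U l"
      using PiE_mem[OF that, of "l + m - 1"] by (simp only: compose_indices_def if_False)
  qed
  have Bb: "B (b x) \<in> R" if "x \<in> ?X" for x
    using b[OF that] B by (auto simp: latin_hypercube_def)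
  have a: "a x \<in> (\<Pi>\<^sub>E j\<in>{1..m}. T j)" if "x \<in> ?X" for x
  proof (unfold a_def, rule restrict_PiE_iff[THEN iffD2], rule ballI)
    fix j assume j: "j \<in> {1..m}"
    then have "j \<in> {1..m + k - 1}" using k by auto
    from PiE_mem[OF that this] show "(if j < m then x j else \<sigma> (B (b x))) \<in> T j"
      using j Bb[OF that] \<sigma> by (auto simp: compose_indices_def)
  qed
  have "A (a x) \<noteq> A (a y)"
    if x: "x \<in> ?X" and y: "y \<in> ?X" and ex: "\<exists>!j. j \<in> {1..m + k - 1} \<and> x j \<noteq> y j" for x y
  proof -
    from ex obtain i where i: "i \<in> {1..m + k - 1}" "x i \<noteq> y i"
      and eq: "\<And>j. j \<in> {1..m + k - 1} \<Longrightarrow> j \<noteq> i \<Longrightarrow> x j = y j"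
      by blast
    have uniq: "j = i" if "j \<in> {1..m + k - 1}" "x j \<noteq> y j" for j
      using eq[OF that(1)] that(2) by auto
    have "\<exists>!j. j \<in> {1..m} \<and> a x j \<noteq> a y j"
    proof (cases "i < m")
      case True
      \<comment> \<open>The inner hypercube reads only coordinates from \<open>m\<close> on, so
        coordinate \<open>m\<close> of \<open>a x\<close> stays fixed.\<close>
      have "b x = b y"
        unfolding b_def using True by (intro restrict_ext eq) auto
      then show ?thesis
        using True i k by (intro ex1I[of _ i]) (auto simp: a_def split: if_splits intro: uniq)
    next
      case False
      have "\<exists>!l. l \<in> {1..k} \<and> b x l \<noteq> b y l"
      proof (rule ex1I[of _ "i + 1 - m"])
        show "i + 1 - m \<in> {1..k} \<and> b x (i + 1 - m) \<noteq> b y (i + 1 - m)"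
          using False i m by (auto simp: b_def)
        fix l assume l: "l \<in> {1..k} \<and> b x l \<noteq> b y l"
        then have "l + m - 1 = i"
          using m by (intro uniq) (auto simp: b_def)
        then show "l = i + 1 - m" using m by auto
      qed
      then have "B (b x) \<noteq> B (b y)"
        using B b[OF x] b[OF y] unfolding latin_hypercube_def by blast
      then have "\<sigma> (B (b x)) \<noteq> \<sigma> (B (b y))"
        using inj Bb[OF x] Bb[OF y] by (auto dest: inj_onD)
      \<comment> \<open>Coordinates below \<open>m\<close> differ from \<open>i\<close>, hence
        agree, and only coordinate \<open>m\<close> changes.\<close>
      then show ?thesis
        using False m k eq by (intro ex1I[of _ m]) (auto simp: a_def split: if_splits)
    qed
    then show ?thesis
      using A a[OF x] a[OF y] unfolding latin_hypercube_def by blast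
  qed
  moreover have "A (a x) \<in> S" if "x \<in> ?X" for x
    using a[OF that] A by (auto simp: latin_hypercube_def)
  moreover have "finite (compose_indices m T U j) \<and> card (compose_indices m T U j) = h"
    if "j \<in> {1..m + k - 1}" for j
    by (rule compose_indices_all[OF that, where P = "\<lambda>X _. finite X \<and> card X = h"])
      (use A B in \<open>simp_all add: latin_hypercube_def\<close>)
  moreover have "finite S" "card S = h"
    using A by (simp_all add: latin_hypercube_def)
  ultimately show ?thesis
    unfolding latin_hypercube_def L by (intro conjI ballI impI Pi_I) simp_all
qed

text \<open>Equal cardinalities give a bijection for each block. Disjointness of the
  \<open>S i\<close> lets these be glued into one function, and disjointness of the
  \<open>T i\<close> keeps it injective across blocks.\<close>

lemma disjoint_family_matching:
  assumes S: "disjoint_family_on S I" and T: "disjoint_family_on T I"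
    and fin: "\<And>i. i \<in> I \<Longrightarrow> finite (S i)" "\<And>i. i \<in> I \<Longrightarrow> finite (T i)"
    and card: "\<And>i. i \<in> I \<Longrightarrow> card (S i) = card (T i)"
  obtains f where "bij_betw f (\<Union>i\<in>I. S i) (\<Union>i\<in>I. T i)"
    and "\<And>i. i \<in> I \<Longrightarrow> bij_betw f (S i) (T i)"
proof -
  have "\<forall>i\<in>I. \<exists>g. bij_betw g (S i) (T i)"
    using fin card finite_same_card_bij by blast
  then obtain g where g: "\<And>i. i \<in> I \<Longrightarrow> bij_betw (g i) (S i) (T i)"
    by metis
  define f where "f x = g (THE i. i \<in> I \<and> x \<in> S i) x" for x
  have f: "bij_betw f (S i) (T i)" if "i \<in> I" for i
  proof -
    have "f x = g i x" if "x \<in> S i" for x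
    proof -
      have "(THE i. i \<in> I \<and> x \<in> S i) = i"
        using S \<open>i \<in> I\<close> that by (intro the_equality) (auto simp: disjoint_family_on_def)
      then show ?thesis by (simp add: f_def)
    qed
    then show ?thesis using g[OF that] by (simp cong: bij_betw_cong)
  qed
  show thesis
    using that[OF bij_betw_UNION_disjoint[OF T f] f] by blast
qed

text \<open>By disjointness the union has as many elements as the finite set \<open>Y\<close>
  containing it.\<close>

lemma UN_eq_if_sum_card_eq:
  fixes X :: "'i \<Rightarrow> 'a set"
  assumes "finite I" "disjoint_family_on X I" "finite Y"
    and "\<And>i. i \<in> I \<Longrightarrow> X i \<subseteq> Y" and "(\<Sum>i\<in>I. card (X i)) = card Y"
  shows "(\<Union>i\<in>I. X i) = Y"
proof (rule card_subset_eq)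
  show "card (\<Union>i\<in>I. X i) = card Y"
    using assms by (subst card_UN_disjoint') (auto intro: finite_subset[where B = Y])
qed (use assms in auto)

theorem theorem20:
  fixes n m k :: nat and h :: "nat \<Rightarrow> nat"
  assumes "n \<ge> 1"
    and "\<And>i j. 1 \<le> i \<Longrightarrow> i \<le> j \<Longrightarrow> j \<le> n \<Longrightarrow> h j \<le> h i"
    and "h n > 0"
    and "m \<ge> 1" and "k \<ge> 1"
    and "\<exists>L. realization m n h L"
    and "\<exists>L. realization k n h L"
  shows "\<exists>L. realization (m + k - 1) n h L"
proof -
  define N where "N = (\<Sum>i=1..n. h i)"
  note m = \<open>m \<ge> 1\<close> and k = \<open>k \<ge> 1\<close>
  obtain A T S where A: "latin_hypercube m N (\<lambda>_. {1..N}) {1..N} A"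
    and subA: "\<And>i. i \<in> {1..n} \<Longrightarrow> subhypercube m N A (h i) (T i) (S i)"
    and disjA: "\<And>i i'. i \<in> {1..n} \<Longrightarrow> i' \<in> {1..n} \<Longrightarrow> i \<noteq> i' \<Longrightarrow>
      disjoint_subhypercubes m (T i) (S i) (T i') (S i')"
    using assms(6) unfolding realization_def Let_def N_def by blast
  obtain B U R where B: "latin_hypercube k N (\<lambda>_. {1..N}) {1..N} B"
    and subB: "\<And>i. i \<in> {1..n} \<Longrightarrow> subhypercube k N B (h i) (U i) (R i)"
    and disjB: "\<And>i i'. i \<in> {1..n} \<Longrightarrow> i' \<in> {1..n} \<Longrightarrow> i \<noteq> i' \<Longrightarrow>
      disjoint_subhypercubes k (U i) (R i) (U i') (R i')"
    using assms(7) unfolding realization_def Let_def N_def by blast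
  have disjR: "disjoint_family_on R {1..n}" and disjT: "disjoint_family_on (\<lambda>i. T i m) {1..n}"
    using disjB disjA m by (auto simp: disjoint_family_on_def disjoint_subhypercubes_def)
  have R: "R i \<subseteq> {1..N}" "finite (R i)" "card (R i) = h i"
    and T: "T i m \<subseteq> {1..N}" "finite (T i m)" "card (T i m) = h i" if "i \<in> {1..n}" for i
    using subB[OF that] subA[OF that] m by (auto simp: subhypercube_def latin_hypercube_def)
  obtain \<sigma> where \<sigma>: "bij_betw \<sigma> (\<Union>i\<in>{1..n}. R i) (\<Union>i\<in>{1..n}. T i m)"
    and \<sigma>i: "\<And>i. i \<in> {1..n} \<Longrightarrow> bij_betw \<sigma> (R i) (T i m)"
    using R T by (auto intro: disjoint_family_matching[OF disjR disjT])
  \<comment> \<open>The orders \<open>h i\<close> sum to \<open>N\<close>, so the blocks exhaust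
    \<open>{1..N}\<close> and \<open>\<sigma>\<close> permutes it. This lets one
    \<open>\<sigma>\<close> serve the whole hypercube and all blocks at once.\<close>
  moreover have "(\<Union>i\<in>{1..n}. R i) = {1..N}" "(\<Union>i\<in>{1..n}. T i m) = {1..N}"
    using R(1,3) T(1,3)
    by (intro UN_eq_if_sum_card_eq disjR disjT; simp add: N_def)+
  ultimately have \<sigma>N: "bij_betw \<sigma> {1..N} {1..N}" by simp

  let ?L = "compose_hypercube m k A \<sigma> B"
  let ?T = "\<lambda>i. compose_indices m (T i) (U i)"
  have "compose_indices m (\<lambda>_. {1..N}) (\<lambda>_. {1..N}) = (\<lambda>_. {1..N})"
    by (simp add: compose_indices_def fun_eq_iff)
  then have "latin_hypercube (m + k - 1) N (\<lambda>_. {1..N}) {1..N} ?L"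
    using latin_hypercube_compose[OF m k A B, of \<sigma>] \<sigma>N by (simp add: bij_betw_def)
  moreover have "subhypercube (m + k - 1) N ?L (h i) (?T i) (S i)" if i: "i \<in> {1..n}" for i
  proof -
    \<comment> \<open>On block \<open>i\<close> the values of \<open>B\<close> lie in
      \<open>R i\<close>, which \<open>\<sigma>\<close> carries into \<open>T i m\<close>, so
      \<open>A\<close> is evaluated inside its own \<open>i\<close>-th subhypercube and returns
      symbols of \<open>S i\<close>.\<close>
    have "latin_hypercube (m + k - 1) (h i) (?T i) (S i) ?L"
      using latin_hypercube_compose[OF m k, of "h i" "T i" "S i" A "U i" "R i" B \<sigma>]
        subA[OF i] subB[OF i] \<sigma>i[OF i] by (auto simp: subhypercube_def bij_betw_def)
    moreover have "?T i j \<subseteq> {1..N}" if "j \<in> {1..m + k - 1}" for j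
      by (rule compose_indices_all[OF that, where P = "\<lambda>X _. X \<subseteq> {1..N}"])
        (use subA[OF i] subB[OF i] in \<open>simp_all add: subhypercube_def\<close>)
    ultimately show ?thesis
      using subA[OF i] by (auto simp: subhypercube_def)
  qed
  moreover have "disjoint_subhypercubes (m + k - 1) (?T i) (S i) (?T i') (S i')"
    if i: "i \<in> {1..n}" "i' \<in> {1..n}" "i \<noteq> i'" for i i'
  proof -
    have "?T i j \<inter> ?T i' j = {}" if j: "j \<in> {1..m + k - 1}" for j
      by (rule compose_indices_all[OF j, where P = "\<lambda>X Y. X \<inter> Y = {}"])
        (use disjA[OF i] disjB[OF i] in \<open>simp_all add: disjoint_subhypercubes_def\<close>)
    then show ?thesis
      using disjA[OF i] by (simp add: disjoint_subhypercubes_def)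
  qed
  ultimately show ?thesis
    unfolding realization_def Let_def N_def[symmetric]
    by (intro exI[of _ ?L] conjI exI[of _ ?T] exI[of _ S] ballI impI)
qed

end
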